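(* Let $(X,\sigma)$ be a connected Klein surface, let $x\in X$, and let $p:(\widetilde X,\tilde x)\to(X,x)$ be a universal cover of $X$. Let $\alpha:\pi_1^{\mathbb R}((X,\sigma);x)\to\{\mathrm{Id}_X,\sigma\}^{\mathrm{op}}\simeq\mathbb Z/2\mathbb Z$ be the group homomorphism $f\mapsto\sigma_f$. Then there is a short exact sequence $$1\to\pi_1(X;x)\to\pi_1^{\mathbb R}((X,\sigma);x)\xrightarrow{\ \alpha\ }\mathbb Z/2\mathbb Z\to1,$$ showing in particular that $\pi_1(X;x)$ is an index two subgroup of $\pi_1^{\mathbb R}((X,\sigma);x)$.
   Context: A (connected) Klein surface $(X,\sigma)$ is a connected Riemann surface $X$ (without boundary) together with an anti-holomorphic involution $\sigma:X\to X$. A universal cover $p:(\widetilde X,\tilde x)\to(X,x)$ is a simply connected (connected) pointed topological covering, with the unique complex structure on $\widetilde X$ making $p$ holomorphic. The fundamental group of $(X,\sigma)$ is $$\pi_1^{\mathbb R}((X,\sigma);x):=\{f:\widetilde X\to\widetilde X\text{ self-diffeomorphism}\mid\exists\,\sigma_f\in\{\mathrm{Id}_X,\sigma\},\ p\circ f=\sigma_f\circ p\}$$ with group law $f\cdot g:=g\circ f$ (the opposite of composition); the element $\sigma_f$ is uniquely determined by $f$. The topological fundamental group is $\pi_1(X;x):=\mathrm{Aut}(\widetilde X/X)^{\mathrm{op}}=\{f\in\pi_1^{\mathbb R}((X,\sigma);x)\mid p\circ f=p\}$, with the same group law; the first map in the sequence is the inclusion. *)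

theory Defs
  imports "HOL-Analysis.Analysis" "HOL-Algebra.Elementary_Groups"
begin

section \<open>Riemann surfaces\<close>

text \<open>
  The underlying space of a surface is a topological type; its complex structure is given by a
  holomorphic atlas. A chart is a pair of an open domain and a coordinate function, the latter
  being meaningful on the domain only. All notions below are unchanged when an atlas is replaced
  by a compatible one.
\<close>

type_synonym 'a atlas = "('a set \<times> ('a \<Rightarrow> complex)) set"

definition is_chart :: "'a::topological_space set \<Rightarrow> ('a \<Rightarrow> complex) \<Rightarrow> bool" where
  "is_chart U \<phi> \<longleftrightarrow> open U \<and> open (\<phi> ` U) \<and> (\<exists>\<psi>. homeomorphism U (\<phi> ` U) \<phi> \<psi>)"

definition complex_atlas :: "'a::topological_space atlas \<Rightarrow> bool" where
  "complex_atlas A \<longleftrightarrow>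
     (\<forall>(U, \<phi>)\<in>A. is_chart U \<phi>) \<and>
     (\<Union>(U, \<phi>)\<in>A. U) = UNIV \<and>
     (\<forall>(U, \<phi>)\<in>A. \<forall>(V, \<psi>)\<in>A. (\<psi> \<circ> inv_into U \<phi>) holomorphic_on \<phi> ` (U \<inter> V))"

text \<open>
  Second countability is not demanded; for connected surfaces it is automatic (Rado's theorem).
\<close>

definition connected_riemann_surface :: "'a::t2_space atlas \<Rightarrow> bool" where
  "connected_riemann_surface A \<longleftrightarrow> connected (UNIV :: 'a set) \<and> complex_atlas A"

definition in_charts ::
  "((complex \<Rightarrow> complex) \<Rightarrow> complex set \<Rightarrow> bool) \<Rightarrow>
   'a::topological_space atlas \<Rightarrow> 'b::topological_space atlas \<Rightarrow> ('a \<Rightarrow> 'b) \<Rightarrow> bool" where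
  "in_charts P A B f \<longleftrightarrow>
     continuous_on UNIV f \<and>
     (\<forall>(U, \<phi>)\<in>A. \<forall>(V, \<psi>)\<in>B. P (\<psi> \<circ> f \<circ> inv_into U \<phi>) (\<phi> ` (U \<inter> f -` V)))"

definition holomorphic_map ::
  "'a::topological_space atlas \<Rightarrow> 'b::topological_space atlas \<Rightarrow> ('a \<Rightarrow> 'b) \<Rightarrow> bool" where
  "holomorphic_map = in_charts (\<lambda>g S. g holomorphic_on S)"

definition antiholomorphic_map ::
  "'a::topological_space atlas \<Rightarrow> 'b::topological_space atlas \<Rightarrow> ('a \<Rightarrow> 'b) \<Rightarrow> bool" where
  "antiholomorphic_map = in_charts (\<lambda>g S. (cnj \<circ> g) holomorphic_on S)"

text \<open>
  \<open>Ck_on k g S\<close> is real differentiability of class \<open>C^k\<close> on an open set \<open>S\<close>: for finite-dimensional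
  domains, \<open>g\<close> is of class \<open>C^(k+1)\<close> iff it is differentiable and each of its directional
  derivatives is of class \<open>C^k\<close>.
\<close>

fun Ck_on ::
  "nat \<Rightarrow> ('a::euclidean_space \<Rightarrow> 'b::real_normed_vector) \<Rightarrow> 'a set \<Rightarrow> bool" where
  "Ck_on 0 g S \<longleftrightarrow> continuous_on S g"
| "Ck_on (Suc k) g S \<longleftrightarrow>
     (\<forall>z\<in>S. g differentiable (at z)) \<and> (\<forall>v. Ck_on k (\<lambda>z. frechet_derivative g (at z) v) S)"

definition smooth_map ::
  "'a::topological_space atlas \<Rightarrow> 'b::topological_space atlas \<Rightarrow> ('a \<Rightarrow> 'b) \<Rightarrow> bool" where
  "smooth_map = in_charts (\<lambda>g S. \<forall>k. Ck_on k g S)"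

definition self_diffeomorphism :: "'a::topological_space atlas \<Rightarrow> ('a \<Rightarrow> 'a) \<Rightarrow> bool" where
  "self_diffeomorphism A f \<longleftrightarrow> bij f \<and> smooth_map A A f \<and> smooth_map A A (inv_into UNIV f)"


section \<open>Klein surfaces and their universal covers\<close>

definition connected_klein_surface :: "'a::t2_space atlas \<Rightarrow> ('a \<Rightarrow> 'a) \<Rightarrow> bool" where
  "connected_klein_surface A \<sigma> \<longleftrightarrow>
     connected_riemann_surface A \<and> antiholomorphic_map A A \<sigma> \<and> \<sigma> \<circ> \<sigma> = id"

text \<open>
  The atlas \<open>B\<close> of the covering space is any atlas making the covering map holomorphic; up to
  compatibility there is exactly one. The library's notion of simple connectedness includes path
  connectedness.
\<close>

definition universal_cover ::
  "'b::topological_space atlas \<Rightarrow> ('b \<Rightarrow> 'a::t2_space) \<Rightarrow> 'b \<Rightarrow> 'a atlas \<Rightarrow> 'a \<Rightarrow> bool" where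
  "universal_cover B p y A x \<longleftrightarrow>
     covering_space UNIV p UNIV \<and> simply_connected (UNIV :: 'b set) \<and> p y = x \<and>
     complex_atlas B \<and> holomorphic_map B A p"


section \<open>Fundamental groups\<close>

definition pi1_real ::
  "'b::topological_space atlas \<Rightarrow> ('b \<Rightarrow> 'a) \<Rightarrow> ('a \<Rightarrow> 'a) \<Rightarrow> ('b \<Rightarrow> 'b) monoid" where
  "pi1_real B p \<sigma> =
     \<lparr>carrier = {f. self_diffeomorphism B f \<and> (\<exists>s\<in>{id, \<sigma>}. p \<circ> f = s \<circ> p)},
      monoid.mult = (\<lambda>f g. g \<circ> f),
      one = id\<rparr>"

text \<open>
  The opposite group of the automorphisms of the topological covering \<open>p\<close>.
\<close>

definition pi1_top :: "('b::topological_space \<Rightarrow> 'a) \<Rightarrow> ('b \<Rightarrow> 'b) monoid" where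
  "pi1_top p =
     \<lparr>carrier = {f. (\<exists>g. homeomorphism UNIV UNIV f g) \<and> p \<circ> f = p},
      monoid.mult = (\<lambda>f g. g \<circ> f),
      one = id\<rparr>"

definition id_sigma_op :: "('a \<Rightarrow> 'a) \<Rightarrow> ('a \<Rightarrow> 'a) monoid" where
  "id_sigma_op \<sigma> = \<lparr>carrier = {id, \<sigma>}, monoid.mult = (\<lambda>s t. t \<circ> s), one = id\<rparr>"

definition alpha :: "('b \<Rightarrow> 'a) \<Rightarrow> ('a \<Rightarrow> 'a) \<Rightarrow> ('b \<Rightarrow> 'b) \<Rightarrow> ('a \<Rightarrow> 'a)" where
  "alpha p \<sigma> f = (THE s. s \<in> {id, \<sigma>} \<and> p \<circ> f = s \<circ> p)"

lemma alpha_unique: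
  assumes "surj p" and "p \<circ> f = s \<circ> p" and "p \<circ> f = t \<circ> p"
  shows "s = t"
  using assms by (metis surj_fun_eq)

lemma alpha_eqI:
  assumes "surj p" and "s \<in> {id, \<sigma>}" and "p \<circ> f = s \<circ> p"
  shows "alpha p \<sigma> f = s"
  unfolding alpha_def using assms alpha_unique[OF assms(1)] by (intro the_equality) blast+


section \<open>Short exact sequences\<close>

text \<open>
  The library's \<open>exact_seq\<close> requires all groups to have elements of one and the same type.
\<close>

definition short_exact_sequence ::
  "'g monoid \<Rightarrow> ('g \<Rightarrow> 'h) \<Rightarrow> 'h monoid \<Rightarrow> ('h \<Rightarrow> 'k) \<Rightarrow> 'k monoid \<Rightarrow> bool" where
  "short_exact_sequence G i H q K \<longleftrightarrow>
     group_hom G H i \<and> group_hom H K q \<and>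
     inj_on i (carrier G) \<and>
     i ` carrier G = kernel H K q \<and>
     q ` carrier H = carrier K"

end

theory Submission
  imports Defs "HOL-Complex_Analysis.Conformal_Mappings"
begin

text \<open>
  The kernel of \<open>\<alpha>\<close> consists of the deck transformations by definition, provided that every deck
  transformation is a diffeomorphism. Two points carry the proof: this regularity statement,
  and the surjectivity of \<open>\<alpha>\<close>, that is, the existence of an element over \<open>\<sigma>\<close>.

  Regularity: a homeomorphism \<open>f\<close> with \<open>p \<circ> f = s \<circ> p\<close>, where \<open>s\<close> is \<open>id\<close> or \<open>\<sigma>\<close>, satisfies locally
  \<open>f = q \<circ> s \<circ> p\<close> for a local inverse \<open>q\<close> of the local biholomorphism \<open>p\<close>. So \<open>f\<close> is holomorphic or
  antiholomorphic (\<open>covering_lift_holomorphic\<close>), and therefore smooth. Thus both fundamental groups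
  consist of homeomorphisms that are characterized by their compatibility with \<open>p\<close> alone
  (\<open>covering_homeomorphism_self_diffeomorphism\<close>), and the group axioms become a matter of composing
  homeomorphisms.

  Surjectivity: since the covering space is simply connected and locally path connected, \<open>\<sigma> \<circ> p\<close>
  lifts through \<open>p\<close> to a map \<open>f\<close> with \<open>p \<circ> f = \<sigma> \<circ> p\<close> (\<open>covering_lift\<close>). Uniqueness of lifts
  and \<open>\<sigma> \<circ> \<sigma> = id\<close> provide an inverse of \<open>f\<close> (\<open>covering_lift_involution\<close>). The lifting theorem holds
  for coverings of arbitrary topological spaces, because only the domains of paths and homotopies, an interval
  and a square, are subdivided in its proof.

  Finally, the target of \<open>\<alpha>\<close> has exactly two elements because the identity of a Riemann surface is not
  antiholomorphic (\<open>antiholomorphic_id_impossible\<close>). The index is therefore two.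
\<close>

section \<open>Lifting maps through coverings\<close>

definition local_sections :: "('b::topological_space \<Rightarrow> 'a::topological_space) \<Rightarrow> 'a set \<Rightarrow> bool" where
  "local_sections p N \<longleftrightarrow>
     (\<forall>b. p b \<in> N \<longrightarrow> (\<exists>r. continuous_on N r \<and> r (p b) = b \<and> (\<forall>y\<in>N. p (r y) = y)))"

lemma local_sectionsE:
  assumes "local_sections p N" "p b = a" "a \<in> N"
  obtains r where "continuous_on N r" "r a = b" "\<forall>y\<in>N. p (r y) = y"
  using assms unfolding local_sections_def by blast

lemma covering_sheets:
  assumes "covering_space UNIV p UNIV"
  shows "\<exists>N \<V>. open N \<and> a \<in> N \<and> \<Union>\<V> = p -` N \<and> (\<forall>u\<in>\<V>. open u) \<and>
    (\<forall>u\<in>\<V>. \<forall>v\<in>\<V>. u \<noteq> v \<longrightarrow> u \<inter> v = {}) \<and> (\<forall>u\<in>\<V>. \<exists>r. homeomorphism u N p r)"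
proof -
  have "\<exists>N. a \<in> N \<and> open N \<and> (\<exists>\<V>. \<Union>\<V> = p -` N \<and> (\<forall>u\<in>\<V>. open u) \<and> pairwise disjnt \<V> \<and>
      (\<forall>u\<in>\<V>. \<exists>r. homeomorphism u N p r))"
    using assms unfolding covering_space_def by simp
  then obtain N \<V> where "a \<in> N" "open N" "\<Union>\<V> = p -` N" "\<forall>u\<in>\<V>. open u" "pairwise disjnt \<V>"
    "\<forall>u\<in>\<V>. \<exists>r. homeomorphism u N p r"
    by (elim exE conjE)
  then show ?thesis
    by (intro exI[of _ N] exI[of _ \<V>] conjI) (simp_all add: pairwise_def disjnt_def)
qed

lemma covering_local_sections:
  assumes "covering_space UNIV p UNIV"
  obtains N where "open N" "a \<in> N" "local_sections p N"
proof -
  obtain N \<V> where N: "open N" "a \<in> N" "\<Union>\<V> = p -` N" "\<forall>u\<in>\<V>. open u"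
    "\<forall>u\<in>\<V>. \<forall>v\<in>\<V>. u \<noteq> v \<longrightarrow> u \<inter> v = {}" "\<forall>u\<in>\<V>. \<exists>r. homeomorphism u N p r"
    using covering_sheets[OF assms, of a] by (elim exE conjE)
  have "\<exists>r. continuous_on N r \<and> r (p b) = b \<and> (\<forall>y\<in>N. p (r y) = y)" if "p b \<in> N" for b
  proof -
    have "b \<in> \<Union>\<V>" using that unfolding N(3) by simp
    then obtain u where "u \<in> \<V>" "b \<in> u" by (rule UnionE)
    then obtain r where "homeomorphism u N p r" using N(6) by blast
    then show ?thesis using \<open>b \<in> u\<close> unfolding homeomorphism_def by blast
  qed
  then show thesis using that N unfolding local_sections_def by blast
qed

text \<open>
  A point where two lifts agree, or disagree, has a neighbourhood where they do the same: over an
  evenly covered set, two values in one sheet are equal because they have the same image, and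
  values in different sheets stay in these disjoint sheets. Connectedness propagates the agreement.
\<close>

lemma covering_lift_unique:
  assumes cov: "covering_space UNIV p UNIV" and "connected T"
    and g1: "continuous_on T g1" and g2: "continuous_on T g2"
    and eq: "\<And>x. x \<in> T \<Longrightarrow> p (g1 x) = p (g2 x)"
    and a: "a \<in> T" "g1 a = g2 a" and b: "b \<in> T"
  shows "g1 b = g2 b"
proof -
  have "\<forall>x\<in>T. eventually (\<lambda>y. (g1 x = g2 x) = (g1 y = g2 y)) (at x within T)"
  proof
    fix x assume x: "x \<in> T"
    obtain N \<V> where N: "open N" "p (g1 x) \<in> N" "\<Union>\<V> = p -` N" "\<forall>u\<in>\<V>. open u"
      and disj: "\<forall>u\<in>\<V>. \<forall>v\<in>\<V>. u \<noteq> v \<longrightarrow> u \<inter> v = {}"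
      and hom: "\<forall>u\<in>\<V>. \<exists>r. homeomorphism u N p r"
      using covering_sheets[OF cov, of "p (g1 x)"] by (elim exE conjE)
    have "g1 x \<in> \<Union>\<V>" "g2 x \<in> \<Union>\<V>" using N(2) eq[OF x] unfolding N(3) by simp_all
    then obtain u1 u2 where u1: "u1 \<in> \<V>" "g1 x \<in> u1" and u2: "u2 \<in> \<V>" "g2 x \<in> u2"
      by (elim UnionE)
    have inj: "inj_on p u1"
      using hom u1(1) by (metis homeomorphism_apply1 inj_on_inverseI)
    have "eventually (\<lambda>y. g1 y \<in> u1) (at x within T)"
      using g1 x u1 N(4) by (metis continuous_on_def topological_tendstoD)
    moreover have "eventually (\<lambda>y. g2 y \<in> u2) (at x within T)"
      using g2 x u2 N(4) by (metis continuous_on_def topological_tendstoD)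
    moreover have "eventually (\<lambda>y. y \<in> T) (at x within T)"
      by (auto simp: eventually_at_topological)
    ultimately show "eventually (\<lambda>y. (g1 x = g2 x) = (g1 y = g2 y)) (at x within T)"
    proof eventually_elim
      case (elim y)
      show ?case
      proof (cases "u1 = u2")
        case True
        then show ?thesis using inj u1 u2 elim eq[OF x] eq[of y] by (metis inj_onD)
      next
        case False
        then show ?thesis using disj u1 u2 elim by (metis IntI empty_iff)
      qed
    qed
  qed
  from connected_local_const[OF assms(2) a(1) b this] show ?thesis using a(2) by simp
qed

text \<open>
  The lift is required to exist with an arbitrary prescribed value at an arbitrary point of \<open>K\<close>,
  not just at one base point: this is what allows the lifts on two pieces to be matched along
  their overlap.
\<close>

definition liftable :: "('b::topological_space \<Rightarrow> 'a::topological_space)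
    \<Rightarrow> ('c::topological_space \<Rightarrow> 'a) \<Rightarrow> 'c set \<Rightarrow> bool" where
  "liftable p h K \<longleftrightarrow> (\<forall>k\<in>K. \<forall>b. p b = h k \<longrightarrow>
     (\<exists>g. continuous_on K g \<and> g k = b \<and> (\<forall>x\<in>K. p (g x) = h x)))"

lemma liftableE:
  assumes "liftable p h K" "k \<in> K" "p b = h k"
  obtains g where "continuous_on K g" "g k = b" "\<forall>x\<in>K. p (g x) = h x"
  using assms unfolding liftable_def by auto

lemma liftable_over_local_sections:
  assumes "continuous_on K h" "h ` K \<subseteq> N"
    and "local_sections p N"
  shows "liftable p h K"
  unfolding liftable_def
proof (intro ballI allI impI)
  fix k b assume k: "k \<in> K" "p b = h k"
  then have "h k \<in> N" using assms(2) by blast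
  with assms(3) k(2) obtain r where r: "continuous_on N r" "r (h k) = b" "\<forall>y\<in>N. p (r y) = y"
    by (rule local_sectionsE)
  show "\<exists>g. continuous_on K g \<and> g k = b \<and> (\<forall>x\<in>K. p (g x) = h x)"
    using r k assms(1,2)
    by (intro exI[of _ "\<lambda>x. r (h x)"]) (auto intro: continuous_on_compose2)
qed

text \<open>
  A lift on \<open>K\<close> prescribes a value at one point of the overlap, hence a lift on \<open>L\<close>; as the overlap
  is connected, the two lifts agree on all of it and can be pasted.
\<close>

lemma liftable_Un:
  assumes cov: "covering_space UNIV p UNIV"
    and K: "liftable p h K" "closed K" and L: "liftable p h L" "closed L"
    and con: "connected (K \<inter> L)" "K \<inter> L \<noteq> {}"
  shows "liftable p h (K \<union> L)"
proof -
  \<comment> \<open>Extending a lift from the piece that contains the base point; stated for arbitrary pieces,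
    since the base point may lie in either of the given ones.\<close>
  have ext: "\<exists>g. continuous_on (K \<union> L) g \<and> g k = b \<and> (\<forall>x\<in>K \<union> L. p (g x) = h x)"
    if "liftable p h K" "closed K" "liftable p h L" "closed L" "connected (K \<inter> L)" "K \<inter> L \<noteq> {}"
      and k: "k \<in> K" "p b = h k" for K L k b
  proof -
    obtain g where g: "continuous_on K g" "g k = b" "\<forall>x\<in>K. p (g x) = h x"
      using \<open>liftable p h K\<close> k by (rule liftableE)
    obtain m where m: "m \<in> K" "m \<in> L" using \<open>K \<inter> L \<noteq> {}\<close> by blast
    have "p (g m) = h m" using g(3) m(1) by blast
    then obtain g' where g': "continuous_on L g'" "g' m = g m" "\<forall>x\<in>L. p (g' x) = h x"
      by (rule liftableE[OF \<open>liftable p h L\<close> m(2)])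
    have agree: "g x = g' x" if "x \<in> K \<inter> L" for x
      by (rule covering_lift_unique[OF cov \<open>connected (K \<inter> L)\<close>, of g g' m x])
        (use g g' m that in \<open>auto intro: continuous_on_subset\<close>)
    have "continuous_on (K \<union> L) (\<lambda>x. if x \<in> K then g x else g' x)"
      by (rule continuous_on_If) (use that g g' agree in auto)
    then show ?thesis using k g g' by (intro exI[of _ "\<lambda>x. if x \<in> K then g x else g' x"]) auto
  qed
  show ?thesis
    unfolding liftable_def
  proof (intro ballI allI impI)
    fix k b assume k: "k \<in> K \<union> L" "p b = h k"
    show "\<exists>g. continuous_on (K \<union> L) g \<and> g k = b \<and> (\<forall>x\<in>K \<union> L. p (g x) = h x)"
    proof (cases "k \<in> K")
      case True
      then show ?thesis using ext[OF K L con True k(2)] by blast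
    next
      case False
      then have "k \<in> L" using k by blast
      then show ?thesis using ext[OF L K _ _ _ k(2)] con by (metis Int_commute Un_commute)
    qed
  qed
qed

text \<open>
  Subdivision in one coordinate at a time. A sufficiently small box is mapped into a set with
  local sections. For a fixed height \<open>t\<close>, finitely many such boxes side by side make up a strip
  \<open>[a, b] \<times> [c, d]\<close> around \<open>t\<close>, and then finitely many strips make up the whole box. Both compactness
  arguments are instances of the Bolzano principle.
\<close>

lemma liftable_box:
  fixes h :: "real \<times> real \<Rightarrow> 'a::topological_space"
  assumes cov: "covering_space UNIV p UNIV" and h: "continuous_on UNIV h"
    and ab: "a \<le> b" and cd: "c \<le> d"
  shows "liftable p h ({a..b} \<times> {c..d})"
proof -
  have strip: "\<exists>\<delta>>0. \<forall>c d. c \<le> t \<and> t \<le> d \<and> d - c < \<delta> \<longrightarrow> liftable p h ({a..b} \<times> {c..d})"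
    for t :: real
    using ab
  proof (induction rule: Bolzano)
    case (trans a b e)
    obtain \<delta>1 where 1: "\<delta>1 > 0"
      "\<And>c d. c \<le> t \<Longrightarrow> t \<le> d \<Longrightarrow> d - c < \<delta>1 \<Longrightarrow> liftable p h ({a..b} \<times> {c..d})" using trans by blast
    obtain \<delta>2 where 2: "\<delta>2 > 0"
      "\<And>c d. c \<le> t \<Longrightarrow> t \<le> d \<Longrightarrow> d - c < \<delta>2 \<Longrightarrow> liftable p h ({b..e} \<times> {c..d})" using trans by blast
    have "liftable p h ({a..e} \<times> {c..d})" if cd: "c \<le> t" "t \<le> d" "d - c < min \<delta>1 \<delta>2" for c d
    proof -
      have eq: "({a..b} \<times> {c..d}) \<inter> ({b..e} \<times> {c..d}) = {b} \<times> {c..d}"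
        "({a..b} \<times> {c..d}) \<union> ({b..e} \<times> {c..d}) = {a..e} \<times> {c..d}"
        using trans(3,4) by auto
      show ?thesis
        using liftable_Un[OF cov 1(2)[of c d] _ 2(2)[of c d]] cd
        by (simp add: eq closed_Times connected_Times)
    qed
    then show ?case using 1 2 by (intro exI[of _ "min \<delta>1 \<delta>2"]) auto
  next
    case (local x)
    obtain N where N: "open N" "h (x, t) \<in> N" "local_sections p N"
      by (rule covering_local_sections[OF cov, of "h (x, t)"])
    have "open (h -` N)" using N(1) h by (metis continuous_on_open_vimage open_UNIV inf_top_right)
    then obtain U V where UV: "open U" "open V" "x \<in> U" "t \<in> V" "U \<times> V \<subseteq> h -` N"
      using N(2) by (metis mem_Sigma_iff open_prod_elim vimageI2)
    obtain \<delta>1 where 1: "\<delta>1 > 0" "ball x \<delta>1 \<subseteq> U" using UV open_contains_ball by blast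
    obtain \<delta>2 where 2: "\<delta>2 > 0" "ball t \<delta>2 \<subseteq> V" using UV open_contains_ball by blast
    have "liftable p h ({a..b} \<times> {c..d})"
      if "a \<le> x \<and> x \<le> b \<and> b - a < \<delta>1" "c \<le> t \<and> t \<le> d \<and> d - c < \<delta>2" for a b c d
    proof -
      have "{a..b} \<subseteq> U" "{c..d} \<subseteq> V" using that 1 2 by (auto simp: subset_iff dist_real_def)
      then have "{a..b} \<times> {c..d} \<subseteq> h -` N" using UV(5) by blast
      then show ?thesis
        using h N(3) by (intro liftable_over_local_sections) (auto intro: continuous_on_subset)
    qed
    then show ?case using 1 2 by blast
  qed
  show ?thesis
    using cd
  proof (induction rule: Bolzano)
    case (trans c d e)
    have eq: "({a..b} \<times> {c..d}) \<inter> ({a..b} \<times> {d..e}) = {a..b} \<times> {d}"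
      "({a..b} \<times> {c..d}) \<union> ({a..b} \<times> {d..e}) = {a..b} \<times> {c..e}"
      using trans(3,4) by auto
    show ?case
      using liftable_Un[OF cov trans(1) _ trans(2)] ab
      by (simp add: eq closed_Times connected_Times)
  next
    case (local t)
    show ?case using strip[of t] by blast
  qed
qed

text \<open>
  Composing with the retraction of the plane onto the square makes \<open>h\<close> continuous everywhere, so
  boxes around boundary points of the square are handled like all others.
\<close>

lemma covering_square_lift:
  fixes h :: "real \<times> real \<Rightarrow> 'a::topological_space"
  assumes cov: "covering_space UNIV p UNIV" and h: "continuous_on ({0..1} \<times> {0..1}) h"
    and k: "k \<in> {0..1} \<times> {0..1}" "p b = h k"
  obtains g where "continuous_on ({0..1} \<times> {0..1}) g" "g k = b"
    "\<forall>z\<in>{0..1} \<times> {0..1}. p (g z) = h z"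
proof -
  define c where "c = (\<lambda>(s::real, t::real). (max 0 (min 1 s), max 0 (min 1 t)))"
  have c: "c z = z" if "z \<in> {0..1} \<times> {0..1}" for z using that by (auto simp: c_def)
  have "continuous_on UNIV c" unfolding c_def case_prod_unfold by (intro continuous_intros)
  moreover have "range c \<subseteq> {0..1} \<times> {0..1}" by (auto simp: c_def)
  ultimately have "continuous_on UNIV (h \<circ> c)"
    using h by (metis continuous_on_compose continuous_on_subset)
  then have "liftable p (h \<circ> c) ({0..1} \<times> {0..1})"
    by (rule liftable_box[OF cov]) simp_all
  moreover have "p b = (h \<circ> c) k" using k c[OF k(1)] by simp
  ultimately obtain g where "continuous_on ({0..1} \<times> {0..1}) g" "g k = b"
    "\<forall>z\<in>{0..1} \<times> {0..1}. p (g z) = (h \<circ> c) z"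
    using k(1) by (elim liftableE)
  then show thesis using c by (intro that[of g]) auto
qed

lemma covering_path_lift:
  assumes cov: "covering_space UNIV p UNIV" and "path \<gamma>" and "p b = \<gamma> 0"
  obtains \<delta> where "path \<delta>" "\<delta> 0 = b" "\<forall>t\<in>{0..1}. p (\<delta> t) = \<gamma> t"
proof -
  have cont: "continuous_on ({0..1} \<times> {0..1::real}) (\<gamma> \<circ> fst)"
    using \<open>path \<gamma>\<close> unfolding path_def
    by (intro continuous_on_compose continuous_on_fst continuous_on_id) (simp)
  have "(0::real, 0::real) \<in> {0..1} \<times> {0..1}" and "p b = (\<gamma> \<circ> fst) (0, 0)" using assms(3) by simp_all
  then obtain g where g: "continuous_on ({0..1} \<times> {0..1}) g" "g (0::real, 0::real) = b"
    "\<forall>z\<in>{0..1} \<times> {0..1}. p (g z) = (\<gamma> \<circ> fst) z"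
    by (rule covering_square_lift[OF cov cont])
  have "continuous_on {0..1} (g \<circ> (\<lambda>t. (t, 0)))"
    by (intro continuous_on_compose continuous_intros continuous_on_subset[OF g(1)]) auto
  then show thesis using g by (intro that[of "g \<circ> (\<lambda>t. (t, 0))"]) (auto simp: path_def)
qed

text \<open>
  Simple connectedness is used in its free form: \<open>\<gamma>\<close> is homotopic to a constant through loops \<open>H(s, _)\<close>
  whose base point may move. Let \<open>g\<close> lift \<open>f \<circ> H\<close>. Then \<open>g\<close> is constant on the side \<open>s = 1\<close>, so its
  restrictions to the sides \<open>t = 0\<close> and \<open>t = 1\<close> agree at \<open>s = 1\<close>; being lifts of one and the same
  path, they agree at \<open>s = 0\<close> as well, where they are the two ends of \<open>\<delta>\<close>.
\<close>

lemma covering_lift_loop_closed: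
  fixes f :: "'c::topological_space \<Rightarrow> 'a::topological_space"
  assumes cov: "covering_space UNIV p UNIV" and sc: "simply_connected (UNIV :: 'c set)"
    and f: "continuous_on UNIV f" and \<gamma>: "path \<gamma>" "\<gamma> 0 = \<gamma> 1"
    and \<delta>: "path \<delta>" "\<And>t. t \<in> {0..1} \<Longrightarrow> p (\<delta> t) = f (\<gamma> t)"
  shows "\<delta> 0 = \<delta> 1"
proof -
  have "homotopic_loops UNIV \<gamma> (\<lambda>_. \<gamma> 0)"
    using sc \<gamma> unfolding simply_connected_def by (auto simp: pathstart_def pathfinish_def path_def)
  then obtain H where H: "continuous_on ({0..1::real} \<times> {0..1::real}) H"
      "\<And>t. t \<in> {0..1} \<Longrightarrow> H (0,t) = \<gamma> t" "\<And>t. t \<in> {0..1} \<Longrightarrow> H (1,t) = \<gamma> 0"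
      "\<And>s. s \<in> {0..1} \<Longrightarrow> H (s,0) = H (s,1)"
    unfolding homotopic_loops by (auto simp: pathstart_def pathfinish_def)
  have cont: "continuous_on ({0..1} \<times> {0..1}) (f \<circ> H)"
    using H(1) f by (metis continuous_on_compose continuous_on_subset subset_UNIV)
  have "(0::real, 0::real) \<in> {0..1} \<times> {0..1}" and "p (\<delta> 0) = (f \<circ> H) (0, 0)"
    using \<delta>(2)[of 0] H(2)[of 0] by simp_all
  then obtain g where g: "continuous_on ({0..1} \<times> {0..1}) g" "g (0,0) = \<delta> 0"
      "\<forall>z\<in>{0..1} \<times> {0..1}. p (g z) = (f \<circ> H) z"
    by (rule covering_square_lift[OF cov cont])
  have vert: "continuous_on {0..1} (\<lambda>t. g (s, t))" if "s \<in> {0..1}" for s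
    by (rule continuous_on_compose2[OF g(1)]) (use that in \<open>auto intro!: continuous_intros\<close>)
  have hor: "continuous_on {0..1} (\<lambda>s. g (s, t))" if "t \<in> {0..1}" for t
    by (rule continuous_on_compose2[OF g(1)]) (use that in \<open>auto intro!: continuous_intros\<close>)
  have c: "connected {0..1::real}" by simp
  have left: "g (0, 1) = \<delta> 1"
    by (rule covering_lift_unique[OF cov c, of "\<lambda>t. g (0, t)" \<delta> 0])
      (use vert[of 0] \<delta> H g in \<open>auto simp: path_def\<close>)
  have right: "g (1, 1) = g (1, 0)"
    by (rule covering_lift_unique[OF cov c, of "\<lambda>t. g (1, t)" "\<lambda>_. g (1, 0)" 0])
      (use vert[of 1] H g in \<open>auto intro!: continuous_intros\<close>)
  have "g (0, 0) = g (0, 1)"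
    by (rule covering_lift_unique[OF cov c, of "\<lambda>s. g (s, 0)" "\<lambda>s. g (s, 1)" 1])
      (use hor[of 0] hor[of 1] H g right in \<open>auto\<close>)
  then show ?thesis using left g(2) by simp
qed

lemma simply_connected_imp_path:
  fixes a b :: "'c::topological_space"
  assumes "simply_connected (UNIV :: 'c set)"
  obtains \<gamma> where "path \<gamma>" "\<gamma> 0 = a" "\<gamma> 1 = b"
proof -
  have "homotopic_loops UNIV (\<lambda>_::real. a) (\<lambda>_. b)"
    using assms unfolding simply_connected_def by (auto simp: pathstart_def pathfinish_def path_def)
  then obtain H where H: "continuous_on ({0..1::real} \<times> {0..1::real}) H"
      "\<And>t. t \<in> {0..1} \<Longrightarrow> H (0,t) = a" "\<And>t. t \<in> {0..1} \<Longrightarrow> H (1,t) = b"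
    unfolding homotopic_loops by auto
  have "continuous_on {0..1} (\<lambda>s. H (s, 0))"
    by (rule continuous_on_compose2[OF H(1)]) (auto intro!: continuous_intros)
  then show thesis using H by (intro that[of "\<lambda>s. H (s, 0)"]) (auto simp: path_def)
qed

text \<open>
  The value of the lift at \<open>z\<close> is the end of the lifted image of any path from \<open>c0\<close> to \<open>z\<close>. Two such
  paths form a loop, whose image lifts to a closed path, so the value does not depend on the path.
  Near \<open>z\<close> the paths can be continued inside a path-connected neighbourhood, which shows that the
  lift is locally \<open>f\<close> followed by a section of \<open>p\<close>.
\<close>

theorem covering_lift:
  fixes f :: "'c::topological_space \<Rightarrow> 'a::topological_space"
  assumes cov: "covering_space UNIV p UNIV" and sc: "simply_connected (UNIV :: 'c set)"
    and lpc: "\<And>z N. open N \<Longrightarrow> z \<in> N \<Longrightarrow> \<exists>W. open W \<and> (z::'c) \<in> W \<and> W \<subseteq> N \<and> path_connected W"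
    and f: "continuous_on UNIV f" and start: "p b0 = f c0"
  obtains g where "continuous_on UNIV g" "g c0 = b0" "\<forall>z. p (g z) = f z"
proof -
  define R where "R z d \<longleftrightarrow> (\<exists>\<gamma> \<delta>. path \<gamma> \<and> \<gamma> 0 = c0 \<and> \<gamma> 1 = z \<and> path \<delta> \<and> \<delta> 0 = b0 \<and> \<delta> 1 = d
      \<and> (\<forall>t\<in>{0..1}. p (\<delta> t) = f (\<gamma> t)))" for z d
  have fpath: "path (f \<circ> \<gamma>)" if "path \<gamma>" for \<gamma>
    using that f unfolding path_def by (metis continuous_on_compose continuous_on_subset subset_UNIV)
  have ex: "\<exists>d. R z d" for z
  proof -
    obtain \<gamma> where \<gamma>: "path \<gamma>" "\<gamma> 0 = c0" "\<gamma> 1 = z" by (rule simply_connected_imp_path[OF sc])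
    have "p b0 = (f \<circ> \<gamma>) 0" using start \<gamma> by simp
    then obtain \<delta> where "path \<delta>" "\<delta> 0 = b0" "\<forall>t\<in>{0..1}. p (\<delta> t) = (f \<circ> \<gamma>) t"
      by (rule covering_path_lift[OF cov fpath[OF \<gamma>(1)]])
    then show ?thesis
      unfolding R_def using \<gamma>
      by (intro exI[of _ "\<delta> 1"] exI[of _ \<gamma>] exI[of _ \<delta>]) simp
  qed
  have pR: "p d = f z" if "R z d" for z d
    using that unfolding R_def by (metis atLeastAtMost_iff order_refl zero_le_one)
  have uniq: "d = d'" if "R z d" "R z d'" for z d d'
  proof -
    obtain \<gamma> \<delta> where 1: "path \<gamma>" "\<gamma> 0 = c0" "\<gamma> 1 = z" "path \<delta>" "\<delta> 0 = b0" "\<delta> 1 = d"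
      "\<forall>t\<in>{0..1}. p (\<delta> t) = f (\<gamma> t)"
      using \<open>R z d\<close> unfolding R_def by (elim exE conjE)
    obtain \<gamma>' \<delta>' where 2: "path \<gamma>'" "\<gamma>' 0 = c0" "\<gamma>' 1 = z" "path \<delta>'" "\<delta>' 0 = b0" "\<delta>' 1 = d'"
      "\<forall>t\<in>{0..1}. p (\<delta>' t) = f (\<gamma>' t)"
      using \<open>R z d'\<close> unfolding R_def by (elim exE conjE)
    \<comment> \<open>Both paths are run through \<open>c0\<close>, so that the loop is based at \<open>z\<close> and the ends of its lift are
      \<open>d\<close> and \<open>d'\<close>.\<close>
    define loop where "loop = reversepath \<gamma> +++ \<gamma>'"
    have loop: "path loop"
      unfolding loop_def
      by (rule path_join_imp)
        (use 1 2 in \<open>simp_all, simp_all add: pathstart_def pathfinish_def\<close>)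
    have lifted: "path (reversepath \<delta> +++ \<delta>')"
      by (rule path_join_imp)
        (use 1 2 in \<open>simp_all, simp_all add: pathstart_def pathfinish_def\<close>)
    have "(reversepath \<delta> +++ \<delta>') 0 = (reversepath \<delta> +++ \<delta>') 1"
      by (rule covering_lift_loop_closed[OF cov sc f loop _ lifted])
        (use 1 2 in \<open>auto simp: loop_def joinpaths_def reversepath_def\<close>)
    then show ?thesis using 1 2 by (simp add: joinpaths_def reversepath_def)
  qed
  define g where "g z = (THE d. R z d)" for z
  have gR: "R z (g z)" for z unfolding g_def by (rule theI') (use ex uniq in blast)
  have geq: "g z = d" if "R z d" for z d using uniq gR that by blast
  have "\<exists>W. open W \<and> z \<in> W \<and> continuous_on W g" for z
  proof -
    obtain N where N: "open N" "f z \<in> N" "local_sections p N"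
      by (rule covering_local_sections[OF cov, of "f z"])
    obtain r where r: "continuous_on N r" "r (f z) = g z" "\<forall>y\<in>N. p (r y) = y"
      by (rule local_sectionsE[OF N(3) pR[OF gR] N(2)])
    have "open (f -` N)" using N(1) f by (metis continuous_on_open_vimage open_UNIV inf_top_right)
    then obtain W where W: "open W" "z \<in> W" "W \<subseteq> f -` N" "path_connected W"
      using lpc[of "f -` N" z] N(2) by blast
    have "g w = (r \<circ> f) w" if "w \<in> W" for w
    proof (rule geq)
      obtain \<gamma> \<delta> where 1: "path \<gamma>" "\<gamma> 0 = c0" "\<gamma> 1 = z" "path \<delta>" "\<delta> 0 = b0" "\<delta> 1 = g z"
        "\<forall>t\<in>{0..1}. p (\<delta> t) = f (\<gamma> t)"
        using gR[of z] unfolding R_def by (elim exE conjE)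
      have "\<exists>\<eta>. path \<eta> \<and> path_image \<eta> \<subseteq> W \<and> pathstart \<eta> = z \<and> pathfinish \<eta> = w"
        by (rule bspec[OF bspec[OF W(4)[unfolded path_connected_def] W(2)] that])
      then obtain \<eta> where 2: "path \<eta>" "path_image \<eta> \<subseteq> W" "\<eta> 0 = z" "\<eta> 1 = w"
        unfolding pathstart_def pathfinish_def by (elim exE conjE)
      have N\<eta>: "f (\<eta> t) \<in> N" if "t \<in> {0..1}" for t using 2(2) W(3) that unfolding path_image_def by blast
      have 3: "path (r \<circ> f \<circ> \<eta>)"
        unfolding comp_assoc
        by (rule path_continuous_image[OF fpath[OF 2(1)] continuous_on_subset[OF r(1)]])
          (use N\<eta> in \<open>auto simp: path_image_def\<close>)
      show "R w ((r \<circ> f) w)"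
        unfolding R_def
      proof (intro exI[of _ "\<gamma> +++ \<eta>"] exI[of _ "\<delta> +++ (r \<circ> f \<circ> \<eta>)"] conjI ballI)
        show "path (\<gamma> +++ \<eta>)" "path (\<delta> +++ (r \<circ> f \<circ> \<eta>))"
          by (rule path_join_imp; use 1 2 3 r in \<open>simp add: pathstart_def pathfinish_def\<close>)+
        fix t :: real assume "t \<in> {0..1}"
        then show "p ((\<delta> +++ (r \<circ> f \<circ> \<eta>)) t) = f ((\<gamma> +++ \<eta>) t)"
          using 1(7) N\<eta> r(3) by (auto simp: joinpaths_def)
      qed (use 1 2 in \<open>auto simp: joinpaths_def\<close>)
    qed
    moreover have "continuous_on W (r \<circ> f)"
      using W(3) f by (intro continuous_on_compose continuous_on_subset[OF r(1)] continuous_on_subset[OF f]) auto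
    ultimately have "continuous_on W g" by (metis continuous_on_cong)
    then show ?thesis using W by blast
  qed
  then have "\<Union>{W. open W \<and> continuous_on W g} = UNIV" by blast
  moreover have "continuous_on (\<Union>{W. open W \<and> continuous_on W g}) g"
    by (rule continuous_on_open_Union) simp_all
  ultimately have "continuous_on UNIV g" by (rule subst)
  moreover have "R c0 b0"
    unfolding R_def using start
    by (intro exI[of _ "\<lambda>_. c0"] exI[of _ "\<lambda>_. b0"]) (auto simp: path_def)
  then have "g c0 = b0" by (rule geq)
  ultimately show thesis using pR[OF gR] by (intro that[of g]) auto
qed

section \<open>Holomorphic and antiholomorphic maps\<close>

lemma chart_facts:
  assumes "is_chart U \<phi>"
  shows chart_open: "open U" and chart_inj: "inj_on \<phi> U"
    and chart_inverse_continuous: "continuous_on (\<phi> ` U) (inv_into U \<phi>)"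
    and chart_open_image: "open N \<Longrightarrow> open (\<phi> ` (U \<inter> N))"
proof -
  obtain \<psi> where o: "open U" "open (\<phi> ` U)" and \<psi>: "homeomorphism U (\<phi> ` U) \<phi> \<psi>"
    using assms unfolding is_chart_def by blast
  show "open U" by (rule o)
  show inj: "inj_on \<phi> U" using \<psi> by (metis homeomorphism_apply1 inj_on_inverseI)
  have eq: "inv_into U \<phi> w = \<psi> w" if "w \<in> \<phi> ` U" for w
    using that \<psi> inj by (metis homeomorphism_apply1 imageE inv_into_f_f)
  show cont: "continuous_on (\<phi> ` U) (inv_into U \<phi>)"
    using \<psi> eq by (metis continuous_on_cong homeomorphism_cont2)
  assume "open N"
  moreover have "\<phi> ` (U \<inter> N) = \<phi> ` U \<inter> inv_into U \<phi> -` N"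
    using inj by (auto simp: inv_into_f_f)
  ultimately show "open (\<phi> ` (U \<inter> N))"
    using continuous_open_preimage[OF cont o(2)] by simp
qed

lemma atlas_chart_at:
  fixes A :: "'a::topological_space atlas"
  assumes "complex_atlas A"
  obtains U \<phi> where "(U, \<phi>) \<in> A" "is_chart U \<phi>" "y \<in> U"
proof -
  have "y \<in> (\<Union>(U, \<phi>)\<in>A. U)" "\<forall>(U, \<phi>)\<in>A. is_chart U \<phi>"
    using assms unfolding complex_atlas_def by auto
  then show thesis using that by fastforce
qed

lemma atlas_charts: "complex_atlas A \<Longrightarrow> (U, \<phi>) \<in> A \<Longrightarrow> is_chart U \<phi>"
  unfolding complex_atlas_def by blast

lemma atlas_imp_locally_path_connected:
  fixes A :: "'a::topological_space atlas" and z :: 'a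
  assumes A: "complex_atlas A" and N: "open N" "z \<in> N"
  shows "\<exists>W. open W \<and> z \<in> W \<and> W \<subseteq> N \<and> path_connected W"
proof -
  obtain U \<phi> where "(U, \<phi>) \<in> A" and U: "is_chart U \<phi>" "z \<in> U" by (rule atlas_chart_at[OF A])
  have "open (\<phi> ` (U \<inter> N))" "\<phi> z \<in> \<phi> ` (U \<inter> N)" using chart_open_image[OF U(1) N(1)] U N by auto
  then obtain e where e: "e > 0" "ball (\<phi> z) e \<subseteq> \<phi> ` (U \<inter> N)" using open_contains_ball by blast
  define W where "W = inv_into U \<phi> ` ball (\<phi> z) e"
  have inv: "inv_into U \<phi> (\<phi> y) = y" if "y \<in> U" for y using chart_inj[OF U(1)] that by simp
  have pre: "inv_into U \<phi> w \<in> U \<inter> N \<and> \<phi> (inv_into U \<phi> w) = w" if "w \<in> ball (\<phi> z) e" for w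
  proof -
    obtain u where "u \<in> U" "u \<in> N" "w = \<phi> u" using e(2) \<open>w \<in> _\<close> by blast
    then show ?thesis using inv[of u] by simp
  qed
  have WN: "W \<subseteq> N" unfolding W_def using pre by blast
  have W: "W = U \<inter> \<phi> -` ball (\<phi> z) e"
  proof
    show "W \<subseteq> U \<inter> \<phi> -` ball (\<phi> z) e" unfolding W_def using pre by fastforce
    show "U \<inter> \<phi> -` ball (\<phi> z) e \<subseteq> W"
    proof
      fix y assume "y \<in> U \<inter> \<phi> -` ball (\<phi> z) e"
      then show "y \<in> W" unfolding W_def using inv[of y] by (intro image_eqI[of _ _ "\<phi> y"]) auto
    qed
  qed
  have "continuous_on U \<phi>" using U(1) unfolding is_chart_def homeomorphism_def by blast
  then have "open W" unfolding W using chart_open[OF U(1)] by (intro continuous_open_preimage) auto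
  moreover have "path_connected W"
    unfolding W_def using chart_inverse_continuous[OF U(1)] e(2)
    by (intro path_connected_continuous_image) (auto intro: continuous_on_subset convex_imp_path_connected)
  moreover have "z \<in> W" using W U e by simp
  ultimately show ?thesis using WN by blast
qed

text \<open>
  Holomorphic maps are the case \<open>c = id\<close>, antiholomorphic maps the case \<open>c = cnj\<close>. The parameter lets
  the arguments below treat both kinds of maps at once.
\<close>

definition holomorphic_up_to ::
  "(complex \<Rightarrow> complex) \<Rightarrow> 'a::topological_space atlas \<Rightarrow> 'b::topological_space atlas \<Rightarrow> ('a \<Rightarrow> 'b) \<Rightarrow> bool" where
  "holomorphic_up_to c = in_charts (\<lambda>g S. (c \<circ> g) holomorphic_on S)"

lemma holomorphic_map_up_to_id: "holomorphic_map = holomorphic_up_to id"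
  by (simp add: holomorphic_map_def holomorphic_up_to_def)

lemma antiholomorphic_map_up_to_cnj: "antiholomorphic_map = holomorphic_up_to cnj"
  by (simp add: antiholomorphic_map_def holomorphic_up_to_def)

lemma holomorphic_up_toD:
  assumes "holomorphic_up_to c A B f" "(U, \<phi>) \<in> A" "(V, \<psi>) \<in> B"
  shows "(c \<circ> (\<psi> \<circ> f \<circ> inv_into U \<phi>)) holomorphic_on \<phi> ` (U \<inter> f -` V)"
  using assms unfolding holomorphic_up_to_def in_charts_def by blast

lemma holomorphic_up_to_continuous: "holomorphic_up_to c A B f \<Longrightarrow> continuous_on UNIV f"
  unfolding holomorphic_up_to_def in_charts_def by blast

lemma open_preimage: "continuous_on UNIV f \<Longrightarrow> open N \<Longrightarrow> open (f -` N)"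
  by (metis continuous_on_open_vimage open_UNIV inf_top_right)

lemma holomorphic_up_to_localI:
  assumes A: "complex_atlas A" and f: "continuous_on UNIV f"
    and loc: "\<And>U \<phi> V \<psi> y. (U, \<phi>) \<in> A \<Longrightarrow> (V, \<psi>) \<in> B \<Longrightarrow> y \<in> U \<Longrightarrow> f y \<in> V \<Longrightarrow>
      \<exists>N. open N \<and> y \<in> N \<and> (\<lambda>w. c (\<psi> (f (inv_into U \<phi> w)))) holomorphic_on \<phi> ` (U \<inter> N)"
  shows "holomorphic_up_to c A B f"
proof -
  have "(c \<circ> (\<psi> \<circ> f \<circ> inv_into U \<phi>)) holomorphic_on \<phi> ` (U \<inter> f -` V)"
    if UV: "(U, \<phi>) \<in> A" "(V, \<psi>) \<in> B" for U \<phi> V \<psi>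
    unfolding holomorphic_on_def
  proof
    fix w assume "w \<in> \<phi> ` (U \<inter> f -` V)"
    then obtain y where y: "y \<in> U" "f y \<in> V" "w = \<phi> y" by blast
    obtain N where N: "open N" "y \<in> N" "(\<lambda>w. c (\<psi> (f (inv_into U \<phi> w)))) holomorphic_on \<phi> ` (U \<inter> N)"
      using loc[OF UV y(1,2)] by blast
    have "is_chart U \<phi>" using A UV(1) by (rule atlas_charts)
    then have "open (\<phi> ` (U \<inter> N))" using N(1) by (rule chart_open_image)
    then have "(\<lambda>w. c (\<psi> (f (inv_into U \<phi> w)))) field_differentiable (at w)"
      using N y by (intro holomorphic_on_imp_differentiable_at) auto
    then show "(c \<circ> (\<psi> \<circ> f \<circ> inv_into U \<phi>)) field_differentiable (at w within \<phi> ` (U \<inter> f -` V))"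
      by (simp add: o_def field_differentiable_at_within)
  qed
  then show ?thesis using f unfolding holomorphic_up_to_def in_charts_def by blast
qed

text \<open>
  A third chart, around the intermediate point \<open>p y\<close>, splits the composite locally into the two
  given maps in coordinates.
\<close>

lemma holomorphic_up_to_compose:
  assumes D: "complex_atlas D" and A: "complex_atlas A" and B: "complex_atlas B"
    and p: "holomorphic_map D A p" and s: "holomorphic_up_to c A B s"
  shows "holomorphic_up_to c D B (s \<circ> p)"
proof (rule holomorphic_up_to_localI[OF D])
  have pc: "continuous_on UNIV p" and sc: "continuous_on UNIV s"
    using p s holomorphic_up_to_continuous unfolding holomorphic_map_up_to_id by blast+
  show spc: "continuous_on UNIV (s \<circ> p)"
    using pc sc by (metis continuous_on_compose continuous_on_subset subset_UNIV)
  fix U \<phi> V \<psi> y assume *: "(U, \<phi>) \<in> D" "(V, \<psi>) \<in> B" "y \<in> U" "(s \<circ> p) y \<in> V"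
  obtain W \<kappa> where W: "(W, \<kappa>) \<in> A" "is_chart W \<kappa>" "p y \<in> W" by (rule atlas_chart_at[OF A])
  have V: "open V" using atlas_charts[OF B *(2)] by (rule chart_open)
  have inj: "inj_on \<phi> U" using atlas_charts[OF D *(1)] by (rule chart_inj)
  define N where "N = p -` W \<inter> (s \<circ> p) -` V"
  have "((c \<circ> (\<psi> \<circ> s \<circ> inv_into W \<kappa>)) \<circ> (id \<circ> (\<kappa> \<circ> p \<circ> inv_into U \<phi>))) holomorphic_on \<phi> ` (U \<inter> N)"
  proof (rule holomorphic_on_compose_gen)
    show "(id \<circ> (\<kappa> \<circ> p \<circ> inv_into U \<phi>)) holomorphic_on \<phi> ` (U \<inter> N)"
      using holomorphic_up_toD[OF p[unfolded holomorphic_map_up_to_id] *(1) W(1)]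
      by (rule holomorphic_on_subset) (auto simp: N_def)
    show "(c \<circ> (\<psi> \<circ> s \<circ> inv_into W \<kappa>)) holomorphic_on \<kappa> ` (W \<inter> s -` V)"
      by (rule holomorphic_up_toD[OF s W(1) *(2)])
    show "(id \<circ> (\<kappa> \<circ> p \<circ> inv_into U \<phi>)) ` \<phi> ` (U \<inter> N) \<subseteq> \<kappa> ` (W \<inter> s -` V)"
      using inj by (auto simp: N_def)
  qed
  then have "(\<lambda>w. c (\<psi> ((s \<circ> p) (inv_into U \<phi> w)))) holomorphic_on \<phi> ` (U \<inter> N)"
    by (rule holomorphic_transform) (use inj chart_inj[OF W(2)] in \<open>auto simp: N_def\<close>)
  moreover have "open N"
    unfolding N_def using open_preimage[OF pc chart_open[OF W(2)]] open_preimage[OF spc V]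
    by (rule open_Int)
  ultimately show "\<exists>N. open N \<and> y \<in> N \<and>
      (\<lambda>w. c (\<psi> ((s \<circ> p) (inv_into U \<phi> w)))) holomorphic_on \<phi> ` (U \<inter> N)"
    using * W(3) unfolding N_def by auto
qed

lemma holomorphic_conjugate:
  assumes "c \<in> {id, cnj}" "Q holomorphic_on T" "open T"
  shows "(c \<circ> Q \<circ> c) holomorphic_on c ` T"
proof (cases "c = id")
  case False
  then have c: "c = cnj" using assms by simp
  have "cnj ` cnj ` T = T" by (simp add: image_comp)
  moreover have "open (cnj ` T)"
    unfolding image_cnj_conv_vimage_cnj using assms(3) by (intro open_vimage) auto
  ultimately show ?thesis unfolding c using assms(2) by (intro holomorphic_on_compose_cnj_cnj) auto
qed (use assms in simp)

text \<open>
  In coordinates \<open>p\<close> is locally an injective holomorphic function \<open>P\<close>, so it has a holomorphic local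
  inverse \<open>Q\<close>, and \<open>f\<close> is locally \<open>Q\<close> applied to \<open>p \<circ> f\<close>. When \<open>p \<circ> f\<close> is antiholomorphic, \<open>Q\<close> is
  conjugated on both sides to obtain the conjugate of \<open>f\<close>.
\<close>

lemma covering_lift_holomorphic:
  assumes D: "complex_atlas D" and B: "complex_atlas B" and A: "complex_atlas A"
    and cov: "covering_space UNIV p UNIV" and p: "holomorphic_map B A p" and c: "c \<in> {id, cnj}"
    and f: "continuous_on UNIV f" and pf: "holomorphic_up_to c D A (p \<circ> f)"
  shows "holomorphic_up_to c D B f"
proof (rule holomorphic_up_to_localI[OF D f])
  have pc: "continuous_on UNIV p"
    using p holomorphic_up_to_continuous unfolding holomorphic_map_up_to_id by blast
  have cc: "c (c z) = z" for z using c by auto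
  fix U \<phi> V \<psi> y assume *: "(U, \<phi>) \<in> D" "(V, \<psi>) \<in> B" "y \<in> U" "f y \<in> V"
  obtain W \<kappa> where W: "(W, \<kappa>) \<in> A" "is_chart W \<kappa>" "p (f y) \<in> W" by (rule atlas_chart_at[OF A])
  have V: "is_chart V \<psi>" using B *(2) by (rule atlas_charts)
  have inj: "inj_on \<phi> U" using atlas_charts[OF D *(1)] by (rule chart_inj)
  obtain M T q where M: "f y \<in> M" "openin (top_of_set UNIV) M"
    "p (f y) \<in> T" "openin (top_of_set UNIV) T" "homeomorphism M T p q"
    by (rule covering_space_local_homeomorphism[OF cov UNIV_I])
  have injp: "inj_on p M" using M(5) by (metis homeomorphism_apply1 inj_on_inverseI)
  define N where "N = M \<inter> p -` W"
  have N: "open N"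
    unfolding N_def using M(2)[simplified] open_preimage[OF pc chart_open[OF W(2)]] by (rule open_Int)
  have [simp]: "inv_into U \<phi> (\<phi> z) = z" if "z \<in> U" for z using inj that by simp
  have [simp]: "inv_into V \<psi> (\<psi> z) = z" if "z \<in> V" for z using chart_inj[OF V] that by simp
  define P where "P = id \<circ> (\<kappa> \<circ> p \<circ> inv_into V \<psi>)"
  have holP: "P holomorphic_on \<psi> ` (V \<inter> N)"
    unfolding P_def using holomorphic_up_toD[OF p[unfolded holomorphic_map_up_to_id] *(2) W(1)]
    by (rule holomorphic_on_subset) (auto simp: N_def)
  have openN: "open (\<psi> ` (V \<inter> N))" using chart_open_image[OF V N] .
  have injP: "inj_on P (\<psi> ` (V \<inter> N))"
    unfolding inj_on_def P_def N_def using injp chart_inj[OF W(2)] by (auto dest!: inj_onD)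
  obtain Q where Q: "Q holomorphic_on P ` \<psi> ` (V \<inter> N)" "\<And>z. z \<in> \<psi> ` (V \<inter> N) \<Longrightarrow> Q (P z) = z"
    using holomorphic_has_inverse[OF holP openN injP] by metis
  have openP: "open (P ` \<psi> ` (V \<inter> N))" by (rule open_mapping_thm3[OF holP openN injP])
  define L where "L = f -` (V \<inter> N)"
  have "((c \<circ> Q \<circ> c) \<circ> (c \<circ> (\<kappa> \<circ> (p \<circ> f) \<circ> inv_into U \<phi>))) holomorphic_on \<phi> ` (U \<inter> L)"
  proof (rule holomorphic_on_compose_gen)
    show "(c \<circ> (\<kappa> \<circ> (p \<circ> f) \<circ> inv_into U \<phi>)) holomorphic_on \<phi> ` (U \<inter> L)"
      using holomorphic_up_toD[OF pf *(1) W(1)]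
      by (rule holomorphic_on_subset) (auto simp: L_def N_def)
    show "(c \<circ> Q \<circ> c) holomorphic_on c ` P ` \<psi> ` (V \<inter> N)"
      by (rule holomorphic_conjugate[OF c Q(1) openP])
    show "(c \<circ> (\<kappa> \<circ> (p \<circ> f) \<circ> inv_into U \<phi>)) ` \<phi> ` (U \<inter> L) \<subseteq> c ` P ` \<psi> ` (V \<inter> N)"
      by (force simp: L_def P_def)
  qed
  moreover have "((c \<circ> Q \<circ> c) \<circ> (c \<circ> (\<kappa> \<circ> (p \<circ> f) \<circ> inv_into U \<phi>))) w = c (\<psi> (f (inv_into U \<phi> w)))"
    if "w \<in> \<phi> ` (U \<inter> L)" for w
  proof -
    obtain u where u: "u \<in> U" "f u \<in> V" "f u \<in> N" "w = \<phi> u" using \<open>w \<in> _\<close> by (auto simp: L_def)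
    then have "Q (\<kappa> (p (f u))) = \<psi> (f u)" using Q(2)[of "\<psi> (f u)"] by (simp add: P_def)
    then show ?thesis using u by (simp add: cc)
  qed
  ultimately have "(\<lambda>w. c (\<psi> (f (inv_into U \<phi> w)))) holomorphic_on \<phi> ` (U \<inter> L)"
    by (rule holomorphic_transform)
  moreover have "open L"
    unfolding L_def using f open_Int[OF chart_open[OF V] N] by (rule open_preimage)
  ultimately show "\<exists>L. open L \<and> y \<in> L \<and>
      (\<lambda>w. c (\<psi> (f (inv_into U \<phi> w)))) holomorphic_on \<phi> ` (U \<inter> L)"
    using *(4) M(1) W(3) unfolding L_def N_def by auto
qed

text \<open>
  The directional derivatives of \<open>h\<close> are \<open>deriv h\<close> times a constant, again holomorphic, and the real
  linear map \<open>c\<close> commutes with differentiation; so the hypotheses reproduce themselves under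
  differentiation. The function \<open>g\<close> is only prescribed on \<open>S\<close>, since its derivative is known there only.
\<close>

lemma Ck_on_conjugate_holomorphic:
  assumes S: "open S" and c: "c \<in> {id, cnj}"
    and h: "h holomorphic_on S" and g: "\<And>z. z \<in> S \<Longrightarrow> g z = c (h z)"
  shows "Ck_on k g S"
  using h g
proof (induction k arbitrary: g h)
  case 0
  have "continuous_on S (\<lambda>z. c (h z))"
    using holomorphic_on_imp_continuous_on[OF 0(1)] c by (auto intro: continuous_on_cnj)
  then show ?case using 0(2) by (simp cong: continuous_on_cong)
next
  case (Suc k)
  have bl: "bounded_linear c" using c bounded_linear_cnj bounded_linear_ident by (auto simp: id_def)
  have der: "(g has_derivative (\<lambda>v. c (deriv h z * v))) (at z)" if z: "z \<in> S" for z
  proof -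
    have "(h has_derivative (\<lambda>v. deriv h z * v)) (at z)"
      using holomorphic_derivI[OF Suc.prems(1) S z] by (simp add: has_field_derivative_def)
    then have "((\<lambda>z. c (h z)) has_derivative (\<lambda>v. c (deriv h z * v))) (at z)"
      by (rule bounded_linear.has_derivative[OF bl])
    then show ?thesis
      by (rule has_derivative_transform_within_open[OF _ S z]) (simp add: Suc.prems)
  qed
  have "Ck_on k (\<lambda>z. frechet_derivative g (at z) v) S" for v
  proof (rule Suc.IH)
    show "(\<lambda>z. deriv h z * v) holomorphic_on S"
      by (intro holomorphic_intros Suc.prems(1) S)
    show "frechet_derivative g (at z) v = c (deriv h z * v)" if "z \<in> S" for z
      using frechet_derivative_at[OF der[OF that]] by metis
  qed
  then show ?case using der by (auto simp: differentiable_def)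
qed

lemma holomorphic_up_to_imp_smooth:
  assumes A: "complex_atlas A" and c: "c \<in> {id, cnj}" and f: "holomorphic_up_to c A B f"
    and B: "complex_atlas B"
  shows "smooth_map A B f"
  unfolding smooth_map_def in_charts_def
proof (intro conjI ballI, goal_cases)
  case 1
  show ?case using f by (rule holomorphic_up_to_continuous)
next
  case (2 U\<phi>)
  obtain U \<phi> where U: "U\<phi> = (U, \<phi>)" by fastforce
  have "Ck_on k (\<psi> \<circ> f \<circ> inv_into U \<phi>) (\<phi> ` (U \<inter> f -` V))" if V: "(V, \<psi>) \<in> B" for k V \<psi>
  proof (rule Ck_on_conjugate_holomorphic[OF _ c holomorphic_up_toD[OF f _ V]])
    show "(U, \<phi>) \<in> A" using 2 U by simp
    then have "is_chart U \<phi>" using A by (intro atlas_charts)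
    moreover have "open V" using atlas_charts[OF B V] by (rule chart_open)
    ultimately show "open (\<phi> ` (U \<inter> f -` V))"
      using holomorphic_up_to_continuous[OF f] by (intro chart_open_image open_preimage)
  qed (use c in auto)
  then show ?case unfolding U by blast
qed

text \<open>
  In a chart the identity would make complex conjugation holomorphic on a nonempty open set; but
  its derivative is not complex linear.
\<close>

lemma antiholomorphic_id_impossible:
  fixes A :: "'a::topological_space atlas"
  assumes A: "complex_atlas A"
  shows "\<not> antiholomorphic_map A A id"
proof
  assume a: "antiholomorphic_map A A id"
  obtain U \<phi> y where U: "(U, \<phi>) \<in> A" "is_chart U \<phi>" "y \<in> U"
    by (rule atlas_chart_at[OF A])
  have "(cnj \<circ> (\<phi> \<circ> id \<circ> inv_into U \<phi>)) holomorphic_on \<phi> ` (U \<inter> id -` U)"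
    using holomorphic_up_toD[OF a[unfolded antiholomorphic_map_up_to_cnj] U(1) U(1)] .
  then have "(cnj \<circ> (\<phi> \<circ> id \<circ> inv_into U \<phi>)) holomorphic_on \<phi> ` U" by simp
  then have "cnj holomorphic_on \<phi> ` U"
    by (rule holomorphic_transform) (auto simp: f_inv_into_f)
  moreover have "open (\<phi> ` U)" using U(2) unfolding is_chart_def by blast
  ultimately have "cnj field_differentiable (at (\<phi> y))"
    using U(3) by (intro holomorphic_on_imp_differentiable_at) auto
  then obtain D where D: "(cnj has_derivative (\<lambda>v. D * v)) (at (\<phi> y))"
    unfolding field_differentiable_def has_field_derivative_def by blast
  moreover have "(cnj has_derivative cnj) (at (\<phi> y))"
    using bounded_linear_imp_has_derivative[OF bounded_linear_cnj] .
  ultimately have "(\<lambda>v. D * v) = cnj" by (rule has_derivative_unique)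
  then have "D * 1 = 1" "D * \<i> = - \<i>" by (metis complex_cnj_one, metis complex_cnj_i)
  then show False by (simp add: complex_eq_iff)
qed

section \<open>Homeomorphisms compatible with the covering\<close>

text \<open>
  Choose \<open>y\<close> over \<open>\<sigma> (p x)\<close>. Let \<open>f\<close> and \<open>g\<close> be lifts of \<open>\<sigma> \<circ> p\<close> with \<open>f x = y\<close> and \<open>g y = x\<close>. As \<open>\<sigma>\<close> is an
  involution, \<open>g \<circ> f\<close> and \<open>f \<circ> g\<close> are lifts of \<open>p\<close> with a fixed point, hence the identity.
\<close>

lemma covering_lift_involution:
  fixes p :: "'b::topological_space \<Rightarrow> 'a::topological_space"
  assumes cov: "covering_space UNIV p UNIV" and sc: "simply_connected (UNIV :: 'b set)"
    and lpc: "\<And>z N. open N \<Longrightarrow> z \<in> N \<Longrightarrow> \<exists>W. open W \<and> (z::'b) \<in> W \<and> W \<subseteq> N \<and> path_connected W"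
    and \<sigma>: "continuous_on UNIV \<sigma>" "\<sigma> \<circ> \<sigma> = id"
  obtains f g where "homeomorphism UNIV UNIV f g" "p \<circ> f = \<sigma> \<circ> p"
proof -
  have pc: "continuous_on UNIV p" and surj: "surj p"
    using cov by (auto simp: covering_space_def)
  have cont: "continuous_on UNIV (\<lambda>z. \<sigma> (p z))"
    using pc \<sigma>(1) by (auto intro: continuous_on_compose2)
  have \<sigma>\<sigma>: "\<sigma> (\<sigma> a) = a" for a using \<sigma>(2) by (metis comp_apply id_apply)
  have "path_connected (UNIV :: 'b set)"
    unfolding path_connected_def pathstart_def pathfinish_def
    by (metis simply_connected_imp_path[OF sc] subset_UNIV)
  then have conn: "connected (UNIV :: 'b set)" by (rule path_connected_imp_connected)
  fix x :: 'b
  obtain y where y: "p y = \<sigma> (p x)" using surj by (metis surjD)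
  obtain f where f: "continuous_on UNIV f" "f x = y" "\<forall>z. p (f z) = \<sigma> (p z)"
    by (rule covering_lift[OF cov sc lpc cont y])
  have x: "p x = \<sigma> (p y)" using y \<sigma>\<sigma> by simp
  obtain g where g: "continuous_on UNIV g" "g y = x" "\<forall>z. p (g z) = \<sigma> (p z)"
    by (rule covering_lift[OF cov sc lpc cont x])
  have "g (f z) = z" for z
    by (rule covering_lift_unique[OF cov conn, of "\<lambda>z. g (f z)" "\<lambda>z. z" x])
      (use f g \<sigma>\<sigma> in \<open>auto intro: continuous_on_compose2 continuous_on_id\<close>)
  moreover have "f (g z) = z" for z
    by (rule covering_lift_unique[OF cov conn, of "\<lambda>z. f (g z)" "\<lambda>z. z" y])
      (use f g \<sigma>\<sigma> in \<open>auto intro: continuous_on_compose2 continuous_on_id\<close>)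
  ultimately have "homeomorphism UNIV UNIV f g"
    using f(1) g(1) by (auto simp: homeomorphism_def surj_def) metis+
  then show thesis using f(3) that by (auto simp: o_def)
qed

lemma homeomorphism_inverse_covers:
  assumes "homeomorphism UNIV UNIV f g" "p \<circ> f = s \<circ> p" "s \<circ> s = id"
  shows "p \<circ> g = s \<circ> p"
proof
  fix z
  have "s (s a) = a" for a using assms(3) by (metis comp_apply id_apply)
  moreover have "p z = s (p (g z))"
    using assms(1,2) by (metis UNIV_I comp_apply homeomorphism_apply2)
  ultimately show "(p \<circ> g) z = (s \<circ> p) z" by simp
qed

text \<open>
  Since \<open>s \<circ> p\<close> is holomorphic or antiholomorphic, so is every continuous map that covers \<open>s\<close>; as \<open>s\<close>
  is an involution, this applies to the inverse of \<open>f\<close> as well. Through this lemma, closure of the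
  real fundamental group under composition reduces to that of homeomorphisms.
\<close>

lemma covering_homeomorphism_self_diffeomorphism:
  assumes B: "complex_atlas B" and A: "complex_atlas A" and cov: "covering_space UNIV p UNIV"
    and p: "holomorphic_map B A p" and \<sigma>: "antiholomorphic_map A A \<sigma>" "\<sigma> \<circ> \<sigma> = id"
    and s: "s \<in> {id, \<sigma>}" and fg: "homeomorphism UNIV UNIV f g" and pf: "p \<circ> f = s \<circ> p"
  shows "self_diffeomorphism B f"
proof -
  have smooth: "smooth_map B B h" if h: "continuous_on UNIV h" "p \<circ> h = s \<circ> p" for h
  proof -
    have "\<exists>c\<in>{id, cnj}. holomorphic_up_to c B A (s \<circ> p)"
    proof (cases "s = id")
      case True
      then show ?thesis using p unfolding holomorphic_map_up_to_id by simp
    next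
      case False
      then show ?thesis
        using holomorphic_up_to_compose[OF B A A p \<sigma>(1)[unfolded antiholomorphic_map_up_to_cnj]] s
        by auto
    qed
    then obtain c where c: "c \<in> {id, cnj}" "holomorphic_up_to c B A (p \<circ> h)" using h(2) by auto
    show ?thesis
      by (rule holomorphic_up_to_imp_smooth[OF B c(1) covering_lift_holomorphic[OF B B A cov p c(1) h(1) c(2)] B])
  qed
  have inv: "f (g z) = z" "g (f z) = z" for z using fg by (auto simp: homeomorphism_def)
  have bij: "bij f" using inv by (metis bijI')
  have "inv_into UNIV f = g" using inv bij by (metis inv_equality)
  moreover have "p \<circ> g = s \<circ> p"
    using homeomorphism_inverse_covers[OF fg pf] s \<sigma>(2) by auto
  ultimately show ?thesis
    using smooth[of f] smooth[of g] fg pf bij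
    unfolding self_diffeomorphism_def homeomorphism_def by auto
qed

lemma self_diffeomorphism_imp_homeomorphism:
  "self_diffeomorphism B f \<Longrightarrow> homeomorphism UNIV UNIV f (inv_into UNIV f)"
  unfolding self_diffeomorphism_def smooth_map_def in_charts_def homeomorphism_def
  by (auto simp: bij_is_surj bij_is_inj surj_f_inv_f bij_imp_bij_inv)

section \<open>Short exact sequences and the group of order two\<close>

lemma group_id_sigma_op:
  assumes "\<sigma> \<circ> \<sigma> = id"
  shows "group (id_sigma_op \<sigma>)"
  by (rule groupI) (use assms in \<open>auto simp: id_sigma_op_def o_assoc\<close>)

lemma id_sigma_op_iso_Z2:
  assumes "\<sigma> \<circ> \<sigma> = id" "\<sigma> \<noteq> id"
  shows "(\<lambda>s. if s = id then 0 else 1) \<in> iso (id_sigma_op \<sigma>) (integer_mod_group 2)"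
  using assms
  by (auto simp: iso_def hom_def id_sigma_op_def carrier_integer_mod_group bij_betw_def inj_on_def)

lemma short_exact_sequence_iso:
  assumes "short_exact_sequence G i H q K" "\<theta> \<in> iso K L" "group L"
  shows "short_exact_sequence G i H (\<theta> \<circ> q) L"
proof -
  interpret q: group_hom H K q using assms(1) unfolding short_exact_sequence_def by blast
  interpret \<theta>: group_hom K L \<theta>
    using assms(2,3) q.group_axioms q.H.group_axioms
    by (auto simp: group_hom_def group_hom_axioms_def iso_def)
  have bij: "inj_on \<theta> (carrier K)" "\<theta> ` carrier K = carrier L"
    using assms(2) by (auto simp: iso_def bij_betw_def)
  have "group_hom H L (\<theta> \<circ> q)"
    using hom_compose[OF q.homh \<theta>.homh] assms(3) q.group_axioms
    by (simp add: group_hom_def group_hom_axioms_def)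
  moreover have "kernel H L (\<theta> \<circ> q) = kernel H K q"
    using bij(1) by (auto simp: kernel_def) (metis inj_onD q.H.one_closed q.hom_closed \<theta>.hom_one)
  moreover have "(\<theta> \<circ> q) ` carrier H = carrier L"
    using assms(1) bij(2) unfolding short_exact_sequence_def by (metis image_comp)
  ultimately show ?thesis using assms(1) unfolding short_exact_sequence_def by simp
qed

lemma short_exact_sequence_index:
  assumes "short_exact_sequence G i H q K"
  shows "card (rcosets\<^bsub>H\<^esub> (i ` carrier G)) = card (carrier K)"
proof -
  interpret q: group_hom H K q using assms unfolding short_exact_sequence_def by blast
  have k: "i ` carrier G = kernel H K q" "q ` carrier H = carrier K"
    using assms unfolding short_exact_sequence_def by blast+
  show ?thesis
    using q.FactGroup_iso_set[OF k(2)] unfolding k iso_def FactGroup_def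
    by (auto dest: bij_betw_same_card)
qed

section \<open>The short exact sequence\<close>

theorem proposition2p12:
  fixes A :: "'a::t2_space atlas" and \<sigma> :: "'a \<Rightarrow> 'a" and x :: 'a
    and B :: "'b::topological_space atlas" and p :: "'b \<Rightarrow> 'a" and x' :: 'b
  assumes "connected_klein_surface A \<sigma>"
    and "universal_cover B p x' A x"
  shows "short_exact_sequence
           (pi1_top p) id (pi1_real B p \<sigma>) (alpha p \<sigma>) (id_sigma_op \<sigma>)
       \<and> (\<exists>\<theta>\<in>iso (id_sigma_op \<sigma>) (integer_mod_group 2).
            short_exact_sequence
              (pi1_top p) id (pi1_real B p \<sigma>) (\<theta> \<circ> alpha p \<sigma>) (integer_mod_group 2))
       \<and> subgroup (carrier (pi1_top p)) (pi1_real B p \<sigma>)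
       \<and> card (rcosets\<^bsub>pi1_real B p \<sigma>\<^esub> (carrier (pi1_top p))) = 2"
proof -
  have A: "complex_atlas A" and \<sigma>: "antiholomorphic_map A A \<sigma>" "\<sigma> \<circ> \<sigma> = id"
    using assms(1) by (auto simp: connected_klein_surface_def connected_riemann_surface_def)
  have cov: "covering_space UNIV p UNIV" and sc: "simply_connected (UNIV :: 'b set)"
    and B: "complex_atlas B" and p: "holomorphic_map B A p"
    using assms(2) by (auto simp: universal_cover_def)
  have surj: "surj p" using cov by (rule covering_space_imp_surjective)
  have \<sigma>_cont: "continuous_on UNIV \<sigma>"
    using \<sigma>(1) holomorphic_up_to_continuous unfolding antiholomorphic_map_up_to_cnj by blast
  have \<sigma>_ne: "\<sigma> \<noteq> id" using antiholomorphic_id_impossible[OF A] \<sigma>(1) by blast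
  let ?G = "pi1_top p" and ?H = "pi1_real B p \<sigma>" and ?K = "id_sigma_op \<sigma>"
  have H: "f \<in> carrier ?H \<longleftrightarrow>
      (\<exists>g. homeomorphism UNIV UNIV f g) \<and> (\<exists>s\<in>{id, \<sigma>}. p \<circ> f = s \<circ> p)" for f
  proof -
    have "f \<in> carrier ?H \<longleftrightarrow> self_diffeomorphism B f \<and> (\<exists>s\<in>{id, \<sigma>}. p \<circ> f = s \<circ> p)"
      by (simp add: pi1_real_def)
    moreover have "\<exists>g. homeomorphism UNIV UNIV f g" if "self_diffeomorphism B f"
      using self_diffeomorphism_imp_homeomorphism[OF that] by blast
    moreover have "self_diffeomorphism B f"
      if "homeomorphism UNIV UNIV f g" "s \<in> {id, \<sigma>}" "p \<circ> f = s \<circ> p" for g s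
      using covering_homeomorphism_self_diffeomorphism[OF B A cov p \<sigma> that(2,1,3)] .
    ultimately show ?thesis by meson
  qed
  have Hops: "\<one>\<^bsub>?H\<^esub> = id" "f \<otimes>\<^bsub>?H\<^esub> g = g \<circ> f" for f g by (auto simp: pi1_real_def)
  have G: "f \<in> carrier ?G \<longleftrightarrow> (\<exists>g. homeomorphism UNIV UNIV f g) \<and> p \<circ> f = p" for f
    by (auto simp: pi1_top_def)
  have \<alpha>: "alpha p \<sigma> f = s" if "s \<in> {id, \<sigma>}" "p \<circ> f = s \<circ> p" for f s
    using alpha_eqI[OF surj that] .
  have \<alpha>_rule: "alpha p \<sigma> f \<in> {id, \<sigma>} \<and> p \<circ> f = alpha p \<sigma> f \<circ> p" if "f \<in> carrier ?H" for f
    using that \<alpha> unfolding H by metis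
  have closed: "t \<circ> s \<in> {id, \<sigma>}" if "s \<in> {id, \<sigma>}" "t \<in> {id, \<sigma>}" for s t
    using that \<sigma>(2) by auto
  have pcomp: "p \<circ> (g \<circ> f) = (t \<circ> s) \<circ> p" if "p \<circ> f = s \<circ> p" "p \<circ> g = t \<circ> p" for f g s t
    using that by (metis comp_assoc)
  have hcomp: "homeomorphism UNIV UNIV (g \<circ> f) (f' \<circ> g')"
    if "homeomorphism UNIV UNIV f f'" "homeomorphism UNIV UNIV g g'" for f g f' g' :: "'b \<Rightarrow> 'b"
    using that by (rule homeomorphism_compose)
  have invp: "p \<circ> f' = s \<circ> p"
    if "homeomorphism UNIV UNIV f f'" "p \<circ> f = s \<circ> p" "s \<in> {id, \<sigma>}" for f f' s
    using homeomorphism_inverse_covers[OF that(1,2)] that(3) \<sigma>(2) by auto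
  have group_H: "group ?H"
  proof (rule groupI, unfold Hops)
    show "id \<in> carrier ?H" unfolding H using homeomorphism_ident by (auto simp: id_def)
    show "g \<circ> f \<in> carrier ?H" if "f \<in> carrier ?H" "g \<in> carrier ?H" for f g
      using that hcomp closed pcomp unfolding H by meson
    fix f assume "f \<in> carrier ?H"
    then obtain f' s where f: "homeomorphism UNIV UNIV f f'" "s \<in> {id, \<sigma>}" "p \<circ> f = s \<circ> p"
      unfolding H by blast
    then have "f' \<in> carrier ?H" unfolding H using invp homeomorphism_symD by blast
    moreover have "f \<circ> f' = id" using f(1) by (auto simp: homeomorphism_def fun_eq_iff)
    ultimately show "\<exists>g\<in>carrier ?H. f \<circ> g = id" by blast
  qed (auto simp: o_assoc)
  have group_K: "group ?K" using \<sigma>(2) by (rule group_id_sigma_op)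
  have "alpha p \<sigma> \<in> hom ?H ?K"
  proof (rule homI)
    show "alpha p \<sigma> f \<in> carrier ?K" if "f \<in> carrier ?H" for f
      using \<alpha>_rule[OF that] by (simp add: id_sigma_op_def)
    show "alpha p \<sigma> (f \<otimes>\<^bsub>?H\<^esub> g) = alpha p \<sigma> f \<otimes>\<^bsub>?K\<^esub> alpha p \<sigma> g"
      if "f \<in> carrier ?H" "g \<in> carrier ?H" for f g
      using \<alpha>[OF closed pcomp] \<alpha>_rule[OF that(1)] \<alpha>_rule[OF that(2)]
      by (simp add: Hops id_sigma_op_def)
  qed
  then have hom: "group_hom ?H ?K (alpha p \<sigma>)"
    using group_H group_K by (simp add: group_hom_def group_hom_axioms_def)
  have kernel: "carrier ?G = kernel ?H ?K (alpha p \<sigma>)"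
  proof -
    have "f \<in> carrier ?H \<and> alpha p \<sigma> f = id" if "f \<in> carrier ?G" for f
      using that \<alpha>[of id f] unfolding G H by auto
    moreover have "f \<in> carrier ?G" if "f \<in> carrier ?H" "alpha p \<sigma> f = id" for f
      using that \<alpha>_rule[OF that(1)] unfolding G H by auto
    ultimately show ?thesis by (auto simp: kernel_def id_sigma_op_def)
  qed
  have image: "alpha p \<sigma> ` carrier ?H = carrier ?K"
  proof
    show "alpha p \<sigma> ` carrier ?H \<subseteq> carrier ?K"
      using \<alpha>_rule by (auto simp: id_sigma_op_def)
    obtain f g where f: "homeomorphism UNIV UNIV f g" "p \<circ> f = \<sigma> \<circ> p"
      by (rule covering_lift_involution[OF cov sc atlas_imp_locally_path_connected[OF B] \<sigma>_cont \<sigma>(2)])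
    then have "f \<in> carrier ?H" "alpha p \<sigma> f = \<sigma>" unfolding H using \<alpha>[of \<sigma> f] by blast+
    moreover have "id \<in> carrier ?H" "alpha p \<sigma> id = id"
      using group.is_monoid[OF group_H] monoid.one_closed[of ?H] \<alpha>[of id id] by (auto simp: Hops)
    ultimately show "carrier ?K \<subseteq> alpha p \<sigma> ` carrier ?H"
      unfolding id_sigma_op_def by force
  qed
  have sub: "subgroup (carrier ?G) ?H"
    unfolding kernel by (rule group_hom.subgroup_kernel[OF hom])
  have "?G = ?H\<lparr>carrier := carrier ?G\<rparr>" by (simp add: pi1_top_def pi1_real_def)
  then have "group ?G" using group.subgroup_imp_group[OF group_H sub] by simp
  then have "group_hom ?G ?H id"
    using group_H subgroup.subset[OF sub]
    by (auto simp: group_hom_def group_hom_axioms_def hom_def pi1_top_def pi1_real_def)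
  then have ses: "short_exact_sequence ?G id ?H (alpha p \<sigma>) ?K"
    using hom kernel image by (simp add: short_exact_sequence_def)
  have "card (rcosets\<^bsub>?H\<^esub> (carrier ?G)) = 2"
    using short_exact_sequence_index[OF ses] \<sigma>_ne by (auto simp: id_sigma_op_def)
  then show ?thesis
    using ses sub id_sigma_op_iso_Z2[OF \<sigma>(2) \<sigma>_ne] short_exact_sequence_iso[OF ses]
      group_integer_mod_group by blast
qed

end
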